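(* Let $\Bbbk$ be a field of characteristic zero and let $d\in\mathbb{N}$. Suppose that $A$ is a ternary $\Bbbk$-algebra, with operation $(a_1,a_2,a_3)\mapsto(a_1\,a_2\,a_3)$, satisfying the identity $w_{2d+1}^{(3)}=0$. Then the symmetrized product $$[a_1 a_2 a_3]=(a_1 a_2 a_3) + (a_1 a_3 a_2) + (a_2 a_3 a_1) + (a_2 a_1 a_3) + (a_3 a_1 a_2) + (a_3 a_2 a_1)$$ on $A$ satisfies the identity $t_{2d+1}^{(3)}=0$.
   Context: A ternary algebra is a $\Bbbk$-vector space $A$ with a trilinear operation, with no symmetry or associativity assumed. For odd $n$, $w_n^{(3)}(a_1,\ldots,a_n)$ is the sum of all distinct multilinear terms of degree $n$ obtained by iterating the ternary operation with the arguments $a_1,\ldots,a_n$ placed in the natural order (one term for each planar rooted ternary tree with $n$ leaves). For a totally commutative (i.e. invariant under all permutations of its arguments) trilinear operation on $A$ and odd $n$, $t_n^{(3)}(a_1,\ldots,a_n)$ is the sum of all distinct multilinear terms of degree $n$ in $a_1,\ldots,a_n$ (each used exactly once, in any order) obtained by iterating this operation, where terms that coincide due to total commutativity are counted once (one term for each non-planar rooted ternary tree with leaves labelled bijectively by $1,\ldots,n$). An identity holds if the operation vanishes for all arguments from $A$. *)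

theory Defs
  imports Complex_Main "HOL-Library.Multiset"
begin

locale ternary_algebra = vector_space scale
  for scale :: "'k::field \<Rightarrow> 'a::ab_group_add \<Rightarrow> 'a" +
  fixes mul :: "'a \<Rightarrow> 'a \<Rightarrow> 'a \<Rightarrow> 'a"
  assumes linear_1: "Vector_Spaces.linear scale scale (\<lambda>x. mul x b c)"
    and linear_2: "Vector_Spaces.linear scale scale (\<lambda>x. mul a x c)"
    and linear_3: "Vector_Spaces.linear scale scale (\<lambda>x. mul a b x)"

text \<open>Formal terms in one ternary operation symbol, that is, planar rooted ternary trees with
  labelled leaves.\<close>

datatype 'l tterm = Leaf 'l | Node "'l tterm" "'l tterm" "'l tterm"

primrec leaves :: "'l tterm \<Rightarrow> 'l list" where
  "leaves (Leaf i) = [i]"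
| "leaves (Node r s t) = leaves r @ leaves s @ leaves t"

primrec tval :: "('a \<Rightarrow> 'a \<Rightarrow> 'a \<Rightarrow> 'a) \<Rightarrow> ('l \<Rightarrow> 'a) \<Rightarrow> 'l tterm \<Rightarrow> 'a" where
  "tval mul a (Leaf i) = a i"
| "tval mul a (Node r s t) = mul (tval mul a r) (tval mul a s) (tval mul a t)"

definition ordered_terms :: "nat \<Rightarrow> nat tterm set" where
  "ordered_terms n = {t. leaves t = [1..<Suc n]}"

definition multilinear_terms :: "nat \<Rightarrow> nat tterm set" where
  "multilinear_terms n = {t. distinct (leaves t) \<and> set (leaves t) = {1..n}}"

text \<open>The arguments \<open>a\<^sub>1, \<dots>, a\<^sub>n\<close> are the values of \<open>a\<close> on \<open>{1..n}\<close>; other values are irrelevant.\<close>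

definition w3 :: "nat \<Rightarrow> ('a \<Rightarrow> 'a \<Rightarrow> 'a \<Rightarrow> 'a::ab_group_add) \<Rightarrow> (nat \<Rightarrow> 'a) \<Rightarrow> 'a" where
  "w3 n mul a = (\<Sum>t\<in>ordered_terms n. tval mul a t)"

definition totally_commutative :: "('a \<Rightarrow> 'a \<Rightarrow> 'a \<Rightarrow> 'a) \<Rightarrow> bool" where
  "totally_commutative mul \<longleftrightarrow>
     (\<forall>a b c x y z. {#a, b, c#} = {#x, y, z#} \<longrightarrow> mul a b c = mul x y z)"

text \<open>Coincidence of terms due to total commutativity: the congruence generated by permuting the
  three children of a node. Its classes are the non-planar rooted ternary trees.\<close>

inductive tc_eq :: "'l tterm \<Rightarrow> 'l tterm \<Rightarrow> bool" where
  perm: "{#r, s, t#} = {#r', s', t'#} \<Longrightarrow> tc_eq (Node r s t) (Node r' s' t')"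
| cong: "tc_eq r r' \<Longrightarrow> tc_eq s s' \<Longrightarrow> tc_eq t t' \<Longrightarrow> tc_eq (Node r s t) (Node r' s' t')"
| refl: "tc_eq t t"
| sym: "tc_eq s t \<Longrightarrow> tc_eq t s"
| trans: "tc_eq r s \<Longrightarrow> tc_eq s t \<Longrightarrow> tc_eq r t"

definition tc_classes :: "nat \<Rightarrow> nat tterm set set" where
  "tc_classes n = multilinear_terms n // {(s, t). tc_eq s t}"

text \<open>Meaningful for a totally commutative \<open>mul\<close> only: then all terms in a class have the same value
  (\<open>tval_tc_eq\<close> below), so the choice of representative is immaterial.\<close>

definition t3 :: "nat \<Rightarrow> ('a \<Rightarrow> 'a \<Rightarrow> 'a \<Rightarrow> 'a::ab_group_add) \<Rightarrow> (nat \<Rightarrow> 'a) \<Rightarrow> 'a" where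
  "t3 n mul a = (\<Sum>C\<in>tc_classes n. tval mul a (SOME t. t \<in> C))"

definition symmetrized :: "('a \<Rightarrow> 'a \<Rightarrow> 'a \<Rightarrow> 'a::ab_group_add) \<Rightarrow> 'a \<Rightarrow> 'a \<Rightarrow> 'a \<Rightarrow> 'a" where
  "symmetrized mul a b c =
     mul a b c + mul a c b + mul b c a + mul b a c + mul c a b + mul c b a"

lemma tval_tc_eq:
  assumes "totally_commutative mul" and "tc_eq s t"
  shows "tval mul a s = tval mul a t"
  using assms(2)
proof (induction rule: tc_eq.induct)
  case (perm r s t r' s' t')
  then have "image_mset (tval mul a) {#r, s, t#} = image_mset (tval mul a) {#r', s', t'#}"
    by (rule arg_cong)
  then have "{#tval mul a r, tval mul a s, tval mul a t#}
           = {#tval mul a r', tval mul a s', tval mul a t'#}"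
    by simp
  with assms(1) show ?case unfolding totally_commutative_def tval.simps by blast
qed simp_all

lemma leaves_tc_eq: "tc_eq s t \<Longrightarrow> mset (leaves s) = mset (leaves t)"
proof (induction rule: tc_eq.induct)
  case (perm r s t r' s' t')
  then have "(\<Sum>u\<in>#{#r, s, t#}. mset (leaves u)) = (\<Sum>u\<in>#{#r', s', t'#}. mset (leaves u))"
    by (rule arg_cong)
  then show ?case by (simp add: add.assoc)
qed simp_all

text \<open>In particular, each class of \<open>tc_classes n\<close> consists of terms in \<open>multilinear_terms n\<close>.\<close>

lemma multilinear_terms_tc_eq:
  assumes "tc_eq s t" and "s \<in> multilinear_terms n"
  shows "t \<in> multilinear_terms n"
  using leaves_tc_eq[OF assms(1)] assms(2) mset_eq_imp_distinct_iff mset_eq_setD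
  unfolding multilinear_terms_def by blast

lemma equiv_tc_eq: "equiv UNIV {(s, t). tc_eq s t}"
  by (auto intro!: equivI refl_onI symI transI intro: tc_eq.intros)

lemma totally_commutative_symmetrized: "totally_commutative (symmetrized mul)"
  unfolding totally_commutative_def symmetrized_def
  by (auto simp: add_eq_conv_ex add_ac)

lemma leaves_nonempty: "leaves t \<noteq> []"
  by (induction t) auto

lemma finite_leaves_eq: "finite {t. leaves t = xs}"
proof (induction "length xs" arbitrary: xs rule: less_induct)
  case less
  let ?P = "{(us, vs, zs). us @ vs @ zs = xs \<and> us \<noteq> [] \<and> vs \<noteq> [] \<and> zs \<noteq> []}"
  let ?S = "\<lambda>ys. {t. leaves t = ys}"
  have P: "finite ?P"
  proof (rule finite_subset)
    let ?Q = "{us. set us \<subseteq> set xs \<and> length us \<le> length xs}"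
    show "?P \<subseteq> ?Q \<times> ?Q \<times> ?Q" by auto
    show "finite (?Q \<times> ?Q \<times> ?Q)" using finite_lists_length_le[of "set xs"] by simp
  qed
  have "{t. leaves t = xs} \<subseteq> (\<lambda>x. Leaf x) ` set xs \<union>
      (\<Union>(us, vs, zs)\<in>?P. (\<lambda>(r, s, t). Node r s t) ` (?S us \<times> ?S vs \<times> ?S zs))"
  proof
    fix t assume "t \<in> {t. leaves t = xs}"
    then show "t \<in> (\<lambda>x. Leaf x) ` set xs \<union>
      (\<Union>(us, vs, zs)\<in>?P. (\<lambda>(r, s, t). Node r s t) ` (?S us \<times> ?S vs \<times> ?S zs))"
      by (cases t) (auto simp: leaves_nonempty image_iff)
  qed
  moreover have "finite (?S us \<times> ?S vs \<times> ?S zs)" if "(us, vs, zs) \<in> ?P" for us vs zs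
  proof -
    have "length us < length xs" "length vs < length xs" "length zs < length xs"
      using that by (auto simp: length_greater_0_conv[symmetric] simp del: length_greater_0_conv)
    then show ?thesis using less by blast
  qed
  then have "finite (\<Union>(us, vs, zs)\<in>?P. (\<lambda>(r, s, t). Node r s t) ` (?S us \<times> ?S vs \<times> ?S zs))"
    by (intro finite_UN_I[OF P]) (clarify, blast intro: finite_imageI)
  ultimately show ?case
    by (meson List.finite_set finite_UnI finite_imageI finite_subset)
qed

lemma finite_ordered_terms: "finite (ordered_terms n)"
  unfolding ordered_terms_def by (rule finite_leaves_eq)

lemma finite_multilinear_terms: "finite (multilinear_terms n)"
proof -
  have "multilinear_terms n = (\<Union>xs\<in>{xs. set xs = {1..n} \<and> distinct xs}. {t. leaves t = xs})"
    unfolding multilinear_terms_def by auto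
  then show ?thesis
    using finite_subset_distinct[of "{1..n}"]
    by (auto intro!: finite_UN_I finite_leaves_eq elim!: finite_subset[rotated])
qed

lemma finite_tc_classes: "finite (tc_classes n)"
  unfolding tc_classes_def quotient_def using finite_multilinear_terms by simp

end

theory Submission
  imports Defs
begin

text \<open>For a term \<open>t\<close> with distinct leaves, expanding the symmetrized product at every node of \<open>t\<close>
  yields every planar representative of the non-planar tree \<open>t\<close> exactly once. Hence
  \<open>t3 n (symmetrized mul)\<close> is the sum of the \<open>mul\<close>-values of all multilinear planar terms; grouping
  these by the order of their leaves turns it into a sum of values of \<open>w3 n mul\<close>.\<close>

section \<open>Congruence classes of terms\<close>

text \<open>Inversion for \<open>tc_eq\<close>. Because of \<open>sym\<close> and
  \<open>trans\<close>, case analysis does not give it, so it is proved as an invariant of all five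
  rules; \<open>rel_mset\<close> inherits reflexivity, symmetry and transitivity from
  \<open>tc_eq\<close>.\<close>

lemma tc_eq_children:
  assumes "tc_eq u v"
  shows "case u of Leaf i \<Rightarrow> v = Leaf i
    | Node r s t \<Rightarrow> \<exists>x y z. v = Node x y z \<and> rel_mset tc_eq {#r, s, t#} {#x, y, z#}"
  using assms
proof (induction rule: tc_eq.induct)
  case (perm r s t r' s' t')
  have "rel_mset tc_eq {#r, s, t#} {#r, s, t#}"
    by (intro multiset.rel_refl tc_eq.refl)
  then show ?case by (simp add: perm)
next
  case (cong r r' s s' t t')
  then show ?case by (simp add: rel_mset_Plus rel_mset_Zero)
next
  case (refl t)
  show ?case by (cases t) (auto intro!: multiset.rel_refl tc_eq.refl)
next
  case (sym s t)
  \<comment> \<open>Written as an equation between relations, symmetry passes to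
    \<open>rel_mset\<close> through \<open>rel_flip\<close>.\<close>
  have "tc_eq\<inverse>\<inverse> = (tc_eq :: 'a tterm \<Rightarrow> _)"
    by (auto simp: fun_eq_iff intro: tc_eq.sym)
  then have flip: "rel_mset tc_eq N M" if "rel_mset tc_eq M N" for M N :: "'a tterm multiset"
    using that multiset.rel_flip[of tc_eq M N] by simp
  show ?case
  proof (cases s)
    case (Leaf i)
    with sym.IH show ?thesis by simp
  next
    case (Node x y z)
    with sym.IH obtain x' y' z' where t: "t = Node x' y' z'"
      and "rel_mset tc_eq {#x, y, z#} {#x', y', z'#}" by auto
    from flip[OF this(2)] show ?thesis by (simp add: t Node)
  qed
next
  case (trans r s t)
  \<comment> \<open>Likewise transitivity, written as an inclusion of relations, passes to
    \<open>rel_mset\<close> through \<open>rel_mono\<close> and \<open>rel_compp\<close>.\<close>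
  have "tc_eq OO tc_eq \<le> (tc_eq :: 'a tterm \<Rightarrow> _)"
    by (auto intro: tc_eq.trans)
  then have "rel_mset (tc_eq OO tc_eq) \<le> (rel_mset tc_eq :: 'a tterm multiset \<Rightarrow> _)"
    by (rule multiset.rel_mono)
  then have comp: "rel_mset tc_eq M K" if "rel_mset tc_eq M N" "rel_mset tc_eq N K"
    for M N K :: "'a tterm multiset"
    using that unfolding multiset.rel_compp by blast
  show ?case
  proof (cases r)
    case (Leaf i)
    with trans.IH show ?thesis by simp
  next
    case (Node x y z)
    with trans.IH(1) obtain x' y' z' where s: "s = Node x' y' z'"
      and 1: "rel_mset tc_eq {#x, y, z#} {#x', y', z'#}" by auto
    from s trans.IH(2) obtain x'' y'' z'' where t: "t = Node x'' y'' z''"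
      and 2: "rel_mset tc_eq {#x', y', z'#} {#x'', y'', z''#}" by auto
    from comp[OF 1 2] show ?thesis by (simp add: t Node)
  qed
qed

definition tc_class :: "'l tterm \<Rightarrow> 'l tterm set" where
  "tc_class t = {u. tc_eq t u}"

definition Nodes :: "'l tterm set \<Rightarrow> 'l tterm set \<Rightarrow> 'l tterm set \<Rightarrow> 'l tterm set" where
  "Nodes P Q R = (\<lambda>(x, y, z). Node x y z) ` (P \<times> Q \<times> R)"

lemma Node_in_Nodes [simp]: "Node x y z \<in> Nodes P Q R \<longleftrightarrow> x \<in> P \<and> y \<in> Q \<and> z \<in> R"
  by (force simp: Nodes_def)

lemma finite_Nodes: "finite P \<Longrightarrow> finite Q \<Longrightarrow> finite R \<Longrightarrow> finite (Nodes P Q R)"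
  by (simp add: Nodes_def)

lemma Nodes_disjoint:
  assumes "P \<inter> P' = {} \<or> Q \<inter> Q' = {} \<or> R \<inter> R' = {}"
  shows "Nodes P Q R \<inter> Nodes P' Q' R' = {}"
  using assms by (auto simp: Nodes_def)

lemma tc_class_Leaf: "tc_class (Leaf i) = {Leaf i}"
  using tc_eq_children[of "Leaf i"] by (auto simp: tc_class_def intro: tc_eq.refl)

lemma tc_eq_Node:
  assumes "tc_eq r r'" "tc_eq s s'" "tc_eq t t'" "{#r', s', t'#} = {#x, y, z#}"
  shows "tc_eq (Node r s t) (Node x y z)"
  using assms by (blast intro: tc_eq.intros)

text \<open>The inclusion from left to right is \<open>tc_eq_children\<close>, the other one is
  \<open>tc_eq_Node\<close>. The six orders are listed as in \<open>symmetrized\<close>, so that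
  each set matches one summand of the product.\<close>

lemma tc_class_Node:
  fixes r s t :: "'l tterm"
  defines "R \<equiv> tc_class r" and "S \<equiv> tc_class s" and "T \<equiv> tc_class t"
  shows "tc_class (Node r s t) =
    Nodes R S T \<union> (Nodes R T S \<union> (Nodes S T R \<union> (Nodes S R T \<union> (Nodes T R S \<union> Nodes T S R))))"
    (is "_ = ?U")
proof (intro equalityI subsetI)
  fix u assume "u \<in> tc_class (Node r s t)"
  then obtain x y z where u: "u = Node x y z"
    and "rel_mset tc_eq {#r, s, t#} {#x, y, z#}"
    using tc_eq_children[of "Node r s t" u] by (auto simp: tc_class_def)
  \<comment> \<open>The partners of \<open>r\<close>, \<open>s\<close>, \<open>t\<close> are peeled
    off the multiset one at a time.\<close>
  from this(2) obtain r' M where r': "{#x, y, z#} = add_mset r' M" "tc_eq r r'"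
    and "rel_mset tc_eq {#s, t#} M"
    by (blast dest: msed_rel_invL)
  from this(3) obtain s' N where s': "M = add_mset s' N" "tc_eq s s'" and "rel_mset tc_eq {#t#} N"
    by (blast dest: msed_rel_invL)
  from this(3) obtain t' K where t': "N = add_mset t' K" "tc_eq t t'" and "rel_mset tc_eq {#} K"
    by (blast dest: msed_rel_invL)
  from this(3) have "K = {#}"
    using rel_mset_size by fastforce
  with r' s' t' have "tc_eq r r'" "tc_eq s s'" "tc_eq t t'" "{#x, y, z#} = {#r', s', t'#}"
    by simp_all
  \<comment> \<open>The multiset equation leaves six ways to identify \<open>x\<close>,
    \<open>y\<close>, \<open>z\<close> with \<open>r'\<close>, \<open>s'\<close>,
    \<open>t'\<close>.\<close>
  then show "u \<in> ?U"
    unfolding u R_def S_def T_def tc_class_def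
    by (auto simp: add_eq_conv_ex)
next
  fix u assume "u \<in> ?U"
  then show "u \<in> tc_class (Node r s t)"
    unfolding R_def S_def T_def tc_class_def Nodes_def
    by auto (erule (2) tc_eq_Node, simp add: add_mset_commute)+
qed

lemma finite_tc_class: "finite (tc_class t)"
  by (induction t) (simp_all add: tc_class_Leaf tc_class_Node finite_Nodes)

text \<open>Congruent terms have the same leaves, and every term has at least one leaf.\<close>

lemma tc_class_disjoint:
  assumes "set (leaves s) \<inter> set (leaves t) = {}"
  shows "tc_class s \<inter> tc_class t = {}"
proof -
  have False if "tc_eq s u" "tc_eq t u" for u
  proof -
    have "set (leaves s) = set (leaves t)"
      using that by (metis leaves_tc_eq mset_eq_setD)
    with assms leaves_nonempty[of s] show False by simp
  qed
  then show ?thesis by (auto simp: tc_class_def)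
qed

section \<open>Expanding the symmetrized product\<close>

context
  fixes mul :: "'a::ab_group_add \<Rightarrow> 'a \<Rightarrow> 'a \<Rightarrow> 'a"
  assumes additive: "additive (\<lambda>x. mul x b c)" "additive (\<lambda>x. mul b x c)" "additive (\<lambda>x. mul b c x)"
begin

text \<open>Distributivity: \<open>Node\<close> is injective, so the left side is a triple sum, and
  additivity in each slot moves the sums inside.\<close>

lemma sum_tval_Nodes:
  "sum (tval mul a) (Nodes P Q R) =
    mul (sum (tval mul a) P) (sum (tval mul a) Q) (sum (tval mul a) R)"
proof -
  have "sum (tval mul a) (Nodes P Q R) =
      (\<Sum>x\<in>P. \<Sum>y\<in>Q. \<Sum>z\<in>R. mul (tval mul a x) (tval mul a y) (tval mul a z))"
    unfolding Nodes_def
    by (subst sum.reindex) (auto simp: inj_on_def sum.cartesian_product case_prod_unfold)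
  also have "\<dots> = mul (sum (tval mul a) P) (sum (tval mul a) Q) (sum (tval mul a) R)"
    by (simp add: additive.sum[OF additive(1), symmetric] additive.sum[OF additive(2), symmetric]
        additive.sum[OF additive(3), symmetric])
  finally show ?thesis .
qed

text \<open>Distinct leaves ensure that no planar term is produced twice; for
  \<open>Node (Leaf i) (Leaf i) (Leaf i)\<close> the left side would be six times the right
  side.\<close>

lemma tval_symmetrized:
  assumes "distinct (leaves t)"
  shows "tval (symmetrized mul) a t = sum (tval mul a) (tc_class t)"
  using assms
proof (induction t)
  case (Leaf i)
  show ?case by (simp add: tc_class_Leaf)
next
  case (Node r s t)
  define R S T where "R = tc_class r" and "S = tc_class s" and "T = tc_class t"
  \<comment> \<open>Two different orders of \<open>R\<close>, \<open>S\<close>, \<open>T\<close>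
    differ in some slot, where disjoint classes meet; this makes the six \<open>Nodes\<close> sets
    pairwise disjoint.\<close>
  have disj: "R \<inter> S = {}" "R \<inter> T = {}" "S \<inter> T = {}" "S \<inter> R = {}" "T \<inter> R = {}" "T \<inter> S = {}"
    unfolding R_def S_def T_def using Node.prems by (auto intro!: tc_class_disjoint)
  have fin: "finite R" "finite S" "finite T"
    unfolding R_def S_def T_def by (rule finite_tc_class)+
  have "sum (tval mul a) (tc_class (Node r s t)) =
      sum (tval mul a) (Nodes R S T) + (sum (tval mul a) (Nodes R T S) +
      (sum (tval mul a) (Nodes S T R) + (sum (tval mul a) (Nodes S R T) +
      (sum (tval mul a) (Nodes T R S) + sum (tval mul a) (Nodes T S R)))))"
    unfolding tc_class_Node R_def[symmetric] S_def[symmetric] T_def[symmetric]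
    by (simp add: sum.union_disjoint finite_Nodes fin Int_Un_distrib Nodes_disjoint disj)
  also have "\<dots> = tval (symmetrized mul) a (Node r s t)"
    using Node.prems
    by (simp add: Node.IH sum_tval_Nodes symmetrized_def R_def S_def T_def add.assoc)
  finally show ?case by simp
qed

text \<open>The classes partition the multilinear terms, and by \<open>tval_symmetrized\<close> each
  class contributes the sum over its members.\<close>

lemma t3_symmetrized:
  "t3 n (symmetrized mul) a = sum (tval mul a) (multilinear_terms n)"
proof -
  let ?E = "{(s, t). tc_eq s t}"
  have E: "?E `` {t} = tc_class t" for t
    by (auto simp: tc_class_def)
  have rep: "tval (symmetrized mul) a (SOME t. t \<in> C) = sum (tval mul a) C \<and> finite C
      \<and> C \<subseteq> multilinear_terms n" if C: "C \<in> tc_classes n" for C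
  proof -
    from C obtain t where t: "t \<in> multilinear_terms n" "C = tc_class t"
      unfolding tc_classes_def quotient_def E by blast
    then have sub: "C \<subseteq> multilinear_terms n"
      using multilinear_terms_tc_eq by (auto simp: tc_class_def)
    \<comment> \<open>The class of the chosen representative is again \<open>C\<close>, so
      \<open>tval_symmetrized\<close> applies to it.\<close>
    define s where "s = (SOME t. t \<in> C)"
    have "t \<in> C" using t by (simp add: tc_class_def tc_eq.refl)
    then have s: "s \<in> C" unfolding s_def by (rule someI)
    then have "C = tc_class s"
      using t by (auto simp: tc_class_def intro: tc_eq.sym tc_eq.trans)
    moreover have "distinct (leaves s)"
      using s sub by (auto simp: multilinear_terms_def)
    ultimately show ?thesis
      using sub tval_symmetrized[of s a] finite_tc_class[of s] unfolding s_def by simp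
  qed
  have "multilinear_terms n \<subseteq> \<Union> (tc_classes n)"
    unfolding tc_classes_def quotient_def by (auto intro: tc_eq.refl)
  then have U: "\<Union> (tc_classes n) = multilinear_terms n"
    using rep by blast
  have "tc_classes n \<subseteq> UNIV // ?E"
    by (auto simp: tc_classes_def quotient_def)
  then have disj: "C \<inter> D = {}" if "C \<in> tc_classes n" "D \<in> tc_classes n" "C \<noteq> D" for C D
    using that quotient_disj[OF equiv_tc_eq] by blast
  have "t3 n (symmetrized mul) a = (\<Sum>C\<in>tc_classes n. sum (tval mul a) C)"
    unfolding t3_def using rep by (intro sum.cong) auto
  also have "\<dots> = sum (tval mul a) (\<Union> (tc_classes n))"
    using rep disj by (subst sum.Union_disjoint) auto
  finally show ?thesis unfolding U .
qed

end

section \<open>Relabelling the leaves\<close>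

lemma leaves_map_tterm: "leaves (map_tterm f t) = map f (leaves t)"
  by (induction t) auto

lemma set_tterm_eq_set_leaves: "set_tterm t = set (leaves t)"
  by (induction t) auto

lemma tval_map_tterm: "tval mul a (map_tterm f t) = tval mul (a \<circ> f) t"
  by (induction t) auto

text \<open>Renaming leaves along \<open>f\<close> is a bijection between the two sets of terms,
  since \<open>f\<close> can be inverted on the labels that occur.\<close>

lemma sum_tval_relabel:
  assumes "inj_on f (set ys)"
  shows "(\<Sum>t | leaves t = map f ys. tval mul a t) = (\<Sum>t | leaves t = ys. tval mul (a \<circ> f) t)"
proof (rule sum.reindex_bij_witness[where i = "map_tterm f"
      and j = "map_tterm (inv_into (set ys) f)"])
  fix t assume t: "t \<in> {t. leaves t = map f ys}"
  \<comment> \<open>The composite is the identity only on the image of \<open>set ys\<close>, which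
    contains all leaves of \<open>t\<close>.\<close>
  have "map_tterm (f \<circ> inv_into (set ys) f) t = map_tterm id t"
    by (rule tterm.map_cong) (use t in \<open>auto simp: set_tterm_eq_set_leaves f_inv_into_f\<close>)
  then show *: "map_tterm f (map_tterm (inv_into (set ys) f) t) = t"
    by (simp add: tterm.map_comp tterm.map_id)
  have "map (inv_into (set ys) f \<circ> f) ys = ys"
    using assms by (intro map_idI) simp
  then show "map_tterm (inv_into (set ys) f) t \<in> {t. leaves t = ys}"
    using t by (simp add: leaves_map_tterm)
  show "tval mul (a \<circ> f) (map_tterm (inv_into (set ys) f) t) = tval mul a t"
    by (metis * tval_map_tterm)
next
  fix t assume t: "t \<in> {t. leaves t = ys}"
  have "map_tterm (inv_into (set ys) f \<circ> f) t = map_tterm id t"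
    by (rule tterm.map_cong) (use t assms in \<open>auto simp: set_tterm_eq_set_leaves\<close>)
  then show "map_tterm (inv_into (set ys) f) (map_tterm f t) = t"
    by (simp add: tterm.map_comp tterm.map_id)
  show "map_tterm f t \<in> {t. leaves t = map f ys}"
    using t by (simp add: leaves_map_tterm)
qed

lemma sum_tval_eq_w3:
  assumes "distinct xs" and "length xs = n"
  shows "(\<Sum>t | leaves t = xs. tval mul a t) = w3 n mul (\<lambda>i. a (xs ! (i - 1)))"
proof -
  \<comment> \<open>Leaf labels start at 1, list positions at 0.\<close>
  let ?f = "\<lambda>i. xs ! (i - 1)"
  have "inj_on ?f (set [1..<Suc n])"
    using assms by (auto simp: inj_on_def nth_eq_iff_index_eq)
  moreover have "map ?f [1..<Suc n] = xs"
    using assms by (auto simp del: upt_Suc intro!: nth_equalityI)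
  ultimately show ?thesis
    using sum_tval_relabel[of ?f "[1..<Suc n]" mul a]
    by (simp add: w3_def ordered_terms_def comp_def del: upt_Suc)
qed

text \<open>Each leaf order \<open>xs\<close> contributes \<open>w3\<close> at the arguments
  permuted by \<open>xs\<close>, which is why the identity is assumed for every assignment.\<close>

lemma sum_tval_multilinear_terms:
  assumes "\<And>a. w3 n mul a = 0"
  shows "sum (tval mul a) (multilinear_terms n) = 0"
proof -
  let ?X = "{xs. distinct xs \<and> set xs = {1..n}}"
  have "finite ?X"
    using finite_subset_distinct[of "{1..n}"] by (rule finite_subset[rotated]) auto
  moreover have "multilinear_terms n = (\<Union>xs\<in>?X. {t. leaves t = xs})"
    by (auto simp: multilinear_terms_def)
  ultimately have "sum (tval mul a) (multilinear_terms n) =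
      (\<Sum>xs\<in>?X. \<Sum>t | leaves t = xs. tval mul a t)"
    by (simp only:, subst sum.UNION_disjoint) (auto simp: finite_leaves_eq)
  also have "\<dots> = 0"
  proof (rule sum.neutral, rule ballI)
    fix xs assume "xs \<in> ?X"
    then have "distinct xs" and "length xs = n"
      using distinct_card[of xs] by auto
    then show "(\<Sum>t | leaves t = xs. tval mul a t) = 0"
      using assms by (simp add: sum_tval_eq_w3)
  qed
  finally show ?thesis .
qed

theorem proposition4:
  fixes scale :: "'k::field_char_0 \<Rightarrow> 'a::ab_group_add \<Rightarrow> 'a"
    and mul :: "'a \<Rightarrow> 'a \<Rightarrow> 'a \<Rightarrow> 'a"
    and d :: nat
  assumes "ternary_algebra scale mul"
    and "\<forall>a. w3 (2 * d + 1) mul a = 0"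
  shows "\<forall>a. t3 (2 * d + 1) (symmetrized mul) a = 0"
proof
  fix a
  interpret ternary_algebra scale mul by (rule assms(1))
  have "additive (\<lambda>x. mul x b c)" "additive (\<lambda>x. mul b x c)" "additive (\<lambda>x. mul b c x)" for b c
    using linear_1 linear_2 linear_3
    by (simp_all add: additive_def Vector_Spaces.linear_iff)
  from t3_symmetrized[OF this] sum_tval_multilinear_terms assms(2)
  show "t3 (2 * d + 1) (symmetrized mul) a = 0" by metis
qed

end
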